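(* Let $\mathbb{k}$ be an algebraically closed field, $n$ a positive integer, and $\mathfrak p(C)$ an $n$-dimensional diagonally graded commutative algebra with its fixed homogeneous linear basis $\{p_i\}_{i\in[n]}$, and let $\bar{\mathfrak p}(\bar C)$ be its $(n-1)$-dimensional truncation. Then $\mathfrak p(C)$ is a (graded) central extension of $\bar{\mathfrak p}(\bar C)$ by the $1$-dimensional homogeneous vector space $V$ spanned by $p_n$.
   Context: $[n]=\{1,\dots,n\}$. $\mathcal M_n$ is the set of $n\times n$ symmetric matrices $C=(c_{ij})_{i,j\in[n]}$ over $\mathbb{k}$ with $c_{ij}=0$ if $i+j>n$ and $c_{jk}c_{i,j+k}=c_{ij}c_{i+j,k}$ for all $i,j,k\ge 1$ (where $c_{ij}$ is read as $0$ whenever $i+j>n$). For $C\in\mathcal M_n$, the $n$-dimensional diagonally graded commutative algebra (DGCA) $\mathfrak p(C)$ is the $\mathbb N^+$-graded vector space $\mathfrak p$ with fixed basis $p_1,\dots,p_n$, $\deg p_i=i$, and multiplication $p_ip_j=c_{ij}p_{i+j}$ (where $p_m=0$ for $m>n$); it is a commutative associative graded algebra. Truncation: $\bar{\mathfrak p}$ is the graded subspace of $\mathfrak p$ spanned by $\{p_i\}_{i\in[n-1]}$, and $\bar C=(\bar c_{ij})_{i,j\in[n-1]}$ is given by $\bar c_{ij}=c_{ij}$ if $i+j<n$ and $\bar c_{ij}=0$ otherwise; $\bar{\mathfrak p}(\bar C)$ is the resulting $(n-1)$-dimensional DGCA. Central extension: for a commutative associative graded algebra $A$ and a graded vector space $V$,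 a graded $2$-cocycle is a degree-preserving symmetric bilinear map $\theta:A\times A\to V$ with $\theta(ab,c)=\theta(a,bc)$ for all $a,b,c\in A$. The (graded) central extension $A_\theta$ is $A\oplus V$ with multiplication $(a+v)\cdot_\theta(b+w)=ab+\theta(a,b)$. Saying that $\mathfrak p(C)$ is a central extension of $\bar{\mathfrak p}(\bar C)$ by $V$ means that, under the identification $\mathfrak p=\bar{\mathfrak p}\oplus V$, it equals $\bar{\mathfrak p}(\bar C)_\theta$ as commutative associative graded algebra for some graded $2$-cocycle $\theta$. *)

theory Defs
  imports
    "HOL-Computational_Algebra.Polynomial"
    "HOL-Analysis.Product_Vector"
begin

section \<open>Graded vector spaces and graded commutative algebras\<close>

text \<open>
  A vector space is given by a scalar multiplication \<open>smul\<close> on an ambient type. A graded space or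
  algebra lives on the subspace spanned by its homogeneous components and may be a proper subspace
  of the ambient type. The grading is by the positive integers, so the component of index \<open>0\<close> is
  required to be zero.
\<close>

definition total_space :: "('k::field \<Rightarrow> 'v::ab_group_add \<Rightarrow> 'v) \<Rightarrow> (nat \<Rightarrow> 'v set) \<Rightarrow> 'v set" where
  "total_space smul G = module.span smul (\<Union>i. G i)"

definition graded_vector_space ::
    "('k::field \<Rightarrow> 'v::ab_group_add \<Rightarrow> 'v) \<Rightarrow> (nat \<Rightarrow> 'v set) \<Rightarrow> bool" where
  "graded_vector_space smul G \<longleftrightarrow>
     vector_space smul \<and>
     (\<forall>i. module.subspace smul (G i)) \<and>
     G 0 = {0} \<and>
     (\<forall>I x. finite I \<and> (\<forall>i\<in>I. x i \<in> G i) \<and> (\<Sum>i\<in>I. x i) = 0 \<longrightarrow> (\<forall>i\<in>I. x i = 0))"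

definition linear_on ::
    "('k::field \<Rightarrow> 'v::ab_group_add \<Rightarrow> 'v) \<Rightarrow> ('k \<Rightarrow> 'w::ab_group_add \<Rightarrow> 'w)
       \<Rightarrow> 'v set \<Rightarrow> ('v \<Rightarrow> 'w) \<Rightarrow> bool" where
  "linear_on s1 s2 S f \<longleftrightarrow>
     (\<forall>x\<in>S. \<forall>y\<in>S. f (x + y) = f x + f y) \<and>
     (\<forall>c. \<forall>x\<in>S. f (s1 c x) = s2 c (f x))"

definition bilinear_on ::
    "('k::field \<Rightarrow> 'v::ab_group_add \<Rightarrow> 'v) \<Rightarrow> ('k \<Rightarrow> 'w::ab_group_add \<Rightarrow> 'w)
       \<Rightarrow> 'v set \<Rightarrow> ('v \<Rightarrow> 'v \<Rightarrow> 'w) \<Rightarrow> bool" where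
  "bilinear_on s1 s2 S b \<longleftrightarrow>
     (\<forall>x\<in>S. linear_on s1 s2 S (\<lambda>y. b x y)) \<and>
     (\<forall>y\<in>S. linear_on s1 s2 S (\<lambda>x. b x y))"

text \<open>Only the values of \<open>mult\<close> on the total space are relevant.\<close>

record 'v graded_algebra =
  component :: "nat \<Rightarrow> 'v set"
  mult :: "'v \<Rightarrow> 'v \<Rightarrow> 'v"

abbreviation alg_space ::
    "('k::field \<Rightarrow> 'v::ab_group_add \<Rightarrow> 'v) \<Rightarrow> 'v graded_algebra \<Rightarrow> 'v set" where
  "alg_space smul A \<equiv> total_space smul (component A)"

definition comm_assoc_graded_algebra ::
    "('k::field \<Rightarrow> 'v::ab_group_add \<Rightarrow> 'v) \<Rightarrow> 'v graded_algebra \<Rightarrow> bool" where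
  "comm_assoc_graded_algebra smul A \<longleftrightarrow>
     graded_vector_space smul (component A) \<and>
     bilinear_on smul smul (alg_space smul A) (mult A) \<and>
     (\<forall>i j. \<forall>a\<in>component A i. \<forall>b\<in>component A j. mult A a b \<in> component A (i + j)) \<and>
     (\<forall>a\<in>alg_space smul A. \<forall>b\<in>alg_space smul A. mult A a b = mult A b a) \<and>
     (\<forall>a\<in>alg_space smul A. \<forall>b\<in>alg_space smul A. \<forall>c\<in>alg_space smul A.
        mult A (mult A a b) c = mult A a (mult A b c))"

definition graded_algebra_iso ::
    "('k::field \<Rightarrow> 'v::ab_group_add \<Rightarrow> 'v) \<Rightarrow> 'v graded_algebra
       \<Rightarrow> ('k \<Rightarrow> 'w::ab_group_add \<Rightarrow> 'w) \<Rightarrow> 'w graded_algebra \<Rightarrow> ('v \<Rightarrow> 'w) \<Rightarrow> bool" where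
  "graded_algebra_iso s1 A s2 B f \<longleftrightarrow>
     linear_on s1 s2 (alg_space s1 A) f \<and>
     bij_betw f (alg_space s1 A) (alg_space s2 B) \<and>
     (\<forall>i. f ` component A i = component B i) \<and>
     (\<forall>a\<in>alg_space s1 A. \<forall>b\<in>alg_space s1 A. f (mult A a b) = mult B (f a) (f b))"

section \<open>Graded central extensions\<close>

definition graded_2_cocycle ::
    "('k::field \<Rightarrow> 'v::ab_group_add \<Rightarrow> 'v) \<Rightarrow> 'v graded_algebra
       \<Rightarrow> ('k \<Rightarrow> 'w::ab_group_add \<Rightarrow> 'w) \<Rightarrow> (nat \<Rightarrow> 'w set) \<Rightarrow> ('v \<Rightarrow> 'v \<Rightarrow> 'w) \<Rightarrow> bool" where
  "graded_2_cocycle s1 A s2 V \<theta> \<longleftrightarrow>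
     (\<forall>a\<in>alg_space s1 A. \<forall>b\<in>alg_space s1 A. \<theta> a b \<in> total_space s2 V) \<and>
     bilinear_on s1 s2 (alg_space s1 A) \<theta> \<and>
     (\<forall>i j. \<forall>a\<in>component A i. \<forall>b\<in>component A j. \<theta> a b \<in> V (i + j)) \<and>
     (\<forall>a\<in>alg_space s1 A. \<forall>b\<in>alg_space s1 A. \<theta> a b = \<theta> b a) \<and>
     (\<forall>a\<in>alg_space s1 A. \<forall>b\<in>alg_space s1 A. \<forall>c\<in>alg_space s1 A.
        \<theta> (mult A a b) c = \<theta> a (mult A b c))"

definition central_extension ::
    "'v graded_algebra \<Rightarrow> (nat \<Rightarrow> 'w set) \<Rightarrow> ('v \<Rightarrow> 'v \<Rightarrow> 'w) \<Rightarrow> ('v \<times> 'w) graded_algebra" where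
  "central_extension A V \<theta> =
     \<lparr>component = (\<lambda>i. component A i \<times> V i),
      mult = (\<lambda>x y. (mult A (fst x) (fst y), \<theta> (fst x) (fst y)))\<rparr>"

text \<open>
  Here \<open>E\<close>, \<open>A\<close> and \<open>V\<close> all lie in one ambient space. That the addition map \<open>(a, v) \<mapsto> a + v\<close> is
  bijective onto \<open>E\<close> says that \<open>E\<close> is the internal direct sum of \<open>A\<close> and \<open>V\<close>; that it is an
  isomorphism says that \<open>E\<close> equals the extension of \<open>A\<close> by \<open>\<theta>\<close> under this identification.
\<close>

definition is_graded_central_extension ::
    "('k::field \<Rightarrow> 'v::ab_group_add \<Rightarrow> 'v)
       \<Rightarrow> 'v graded_algebra \<Rightarrow> 'v graded_algebra \<Rightarrow> (nat \<Rightarrow> 'v set) \<Rightarrow> bool" where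
  "is_graded_central_extension smul E A V \<longleftrightarrow>
     comm_assoc_graded_algebra smul E \<and>
     comm_assoc_graded_algebra smul A \<and>
     graded_vector_space smul V \<and>
     (\<exists>\<theta>. graded_2_cocycle smul A smul V \<theta> \<and>
          graded_algebra_iso (module_prod.scale smul smul) (central_extension A V \<theta>) smul E
            (\<lambda>(a, v). a + v))"

section \<open>Diagonally graded commutative algebras\<close>

text \<open>
  An \<open>n \<times> n\<close> matrix with rows and columns indexed by \<open>1, \<dots>, n\<close> is a function on pairs of natural
  numbers vanishing outside that index range. As the entries with \<open>i + j > n\<close> vanish
  too, the reading of \<open>C i j\<close> as \<open>0\<close> for \<open>i + j > n\<close> is built in.
\<close>

definition dgca_matrices :: "nat \<Rightarrow> (nat \<Rightarrow> nat \<Rightarrow> 'k::field) set" where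
  "dgca_matrices n =
     {C. (\<forall>i j. \<not> (i \<in> {1..n} \<and> j \<in> {1..n}) \<longrightarrow> C i j = 0) \<and>
         (\<forall>i j. C i j = C j i) \<and>
         (\<forall>i j. i + j > n \<longrightarrow> C i j = 0) \<and>
         (\<forall>i\<ge>1. \<forall>j\<ge>1. \<forall>k\<ge>1. C j k * C i (j + k) = C i j * C (i + j) k)}"

text \<open>
  The span of \<open>p 1, \<dots>, p n\<close> with \<open>p i\<close> in degree \<open>i\<close> and the bilinear multiplication determined by
  \<open>p i * p j = C i j \<cdot> p (i + j)\<close>. The values \<open>p m\<close> for \<open>m > n\<close> are arbitrary: they only ever
  occur with the coefficient \<open>C i j = 0\<close>.
\<close>

definition dgca ::
    "('k::field \<Rightarrow> 'v::ab_group_add \<Rightarrow> 'v) \<Rightarrow> nat \<Rightarrow> (nat \<Rightarrow> nat \<Rightarrow> 'k) \<Rightarrow> (nat \<Rightarrow> 'v)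
       \<Rightarrow> 'v graded_algebra" where
  "dgca smul n C p =
     \<lparr>component = (\<lambda>i. if i \<in> {1..n} then module.span smul {p i} else {0}),
      mult = (\<lambda>x y. \<Sum>i\<in>{1..n}. \<Sum>j\<in>{1..n}.
                smul (module.representation smul (p ` {1..n}) x (p i)
                       * module.representation smul (p ` {1..n}) y (p j) * C i j) (p (i + j)))\<rparr>"

definition truncate_matrix :: "nat \<Rightarrow> (nat \<Rightarrow> nat \<Rightarrow> 'k::field) \<Rightarrow> nat \<Rightarrow> nat \<Rightarrow> 'k" where
  "truncate_matrix n C i j = (if i + j < n then C i j else 0)"

definition line_in_degree ::
    "('k::field \<Rightarrow> 'v::ab_group_add \<Rightarrow> 'v) \<Rightarrow> nat \<Rightarrow> 'v \<Rightarrow> nat \<Rightarrow> 'v set" where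
  "line_in_degree smul d v i = (if i = d then module.span smul {v} else {0})"

lemma truncate_matrix_in_dgca_matrices:
  assumes "C \<in> dgca_matrices n"
  shows "truncate_matrix n C \<in> dgca_matrices (n - 1)"
proof -
  have "C i 0 = 0" "C 0 i = 0" "C i j = C j i" for i j
    using assms by (auto simp: dgca_matrices_def)
  moreover have "C j k * C i (j + k) = C i j * C (i + j) k" if "i \<ge> 1" "j \<ge> 1" "k \<ge> 1" for i j k
    using assms that by (auto simp: dgca_matrices_def)
  ultimately show ?thesis
    by (auto simp: dgca_matrices_def truncate_matrix_def add.commute add.left_commute not_le)
qed

lemma dgca_mult_basis:
  assumes "vector_space smul" and "inj_on p {1..n}"
    and "\<not> module.dependent smul (p ` {1..n})"
    and "i \<in> {1..n}" "j \<in> {1..n}"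
  shows "mult (dgca smul n C p) (p i) (p j) = smul (C i j) (p (i + j))"
proof -
  interpret vector_space smul by fact
  have rep: "representation (p ` {1..n}) (p a) (p b) = (if b = a then 1 else 0)"
    if "a \<in> {1..n}" "b \<in> {1..n}" for a b
    using representation_basis[of "p ` {1..n}" "p a"] assms(2,3) that
    by (auto simp: inj_on_eq_iff)
  have "mult (dgca smul n C p) (p i) (p j) =
      (\<Sum>a\<in>{1..n}. \<Sum>b\<in>{1..n}. if b = j then (if a = i then smul (C i j) (p (i + j)) else 0) else 0)"
    unfolding dgca_def graded_algebra.simps
    by (intro sum.cong refl) (use assms(4,5) in \<open>auto simp: rep simp del: One_nat_def\<close>)
  also have "\<dots> = smul (C i j) (p (i + j))"
    using assms(4,5) by (simp add: sum.delta)
  finally show ?thesis .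
qed

end

theory Submission
  imports Defs
begin

text \<open>
  The line \<open>V\<close> spanned by the top vector \<open>p n\<close> is annihilated by the whole algebra \<open>E\<close>, because
  degrees above \<open>n\<close> vanish; so \<open>V\<close> is an ideal, and the truncation \<open>A\<close> is the quotient of \<open>E\<close> by
  \<open>V\<close>, realised on the complement spanned by the other basis vectors. On this complement the two
  products differ only in degree \<open>n\<close>, that is by an element of \<open>V\<close>, and this difference
  \<open>\<theta>(a, b) = a \<cdot>\<^sub>E b - a \<cdot>\<^sub>A b\<close> is the cocycle.

  The cocycle identity and the isomorphism are formal consequences. As \<open>V\<close> is annihilated,
  replacing an inner product in \<open>A\<close> by the one in \<open>E\<close> changes nothing after a further
  multiplication in \<open>E\<close>, so the identity for \<open>\<theta>\<close> is the difference of the associativity laws of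
  \<open>E\<close> and \<open>A\<close>. In the same way \<open>(a + v) \<cdot>\<^sub>E (b + w) = a \<cdot>\<^sub>E b = a \<cdot>\<^sub>A b + \<theta>(a, b)\<close>. This is lemma
  \<open>is_graded_central_extensionI\<close>, for any homogeneous annihilated subspace whose quotient is
  realised on a homogeneous complement. What is particular to diagonally graded algebras is that a
  matrix in \<open>dgca_matrices n\<close> does define a commutative associative graded algebra, which is
  checked on basis vectors in \<open>comm_assoc_graded_algebra_dgca\<close>.
\<close>

section \<open>Maps that are linear on a span\<close>

context vector_space
begin

lemma linear_on_span_mem:
  assumes "linear_on scale scale (span S) f" "subspace T" "\<And>x. x \<in> S \<Longrightarrow> f x \<in> T" "x \<in> span S"
  shows "f x \<in> T"
proof -
  have "f (scale 0 0) = scale 0 (f 0)"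
    using assms(1) span_zero unfolding linear_on_def by blast
  then have "subspace {x \<in> span S. f x \<in> T}"
    using assms(1,2) by (auto simp: subspace_def linear_on_def span_zero span_add span_scale)
  then have "span S \<subseteq> {x \<in> span S. f x \<in> T}"
    using assms(3) by (intro span_minimal) (auto intro: span_base)
  then show ?thesis using assms(4) by auto
qed

lemma linear_on_span_zero:
  assumes "linear_on scale scale (span S) f" "\<And>x. x \<in> S \<Longrightarrow> f x = 0" "x \<in> span S"
  shows "f x = 0"
  using linear_on_span_mem[OF assms(1) subspace_single_0 _ assms(3)] assms(2) by simp

lemma bilinear_on_span_mem:
  assumes b: "bilinear_on scale scale (span S) b" and T: "subspace T"
    and S: "\<And>x y. x \<in> S \<Longrightarrow> y \<in> S \<Longrightarrow> b x y \<in> T" and xy: "x \<in> span S" "y \<in> span S"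
  shows "b x y \<in> T"
proof -
  have "b x' y \<in> T" if "x' \<in> S" for x'
    using b T S that xy(2) linear_on_span_mem[of S "b x'" T y]
    by (auto simp: bilinear_on_def span_base)
  then show ?thesis
    using b T xy linear_on_span_mem[of S "\<lambda>x. b x y" T x] by (auto simp: bilinear_on_def)
qed

lemma bilinear_on_span_zero:
  assumes "bilinear_on scale scale (span S) b" "\<And>x y. x \<in> S \<Longrightarrow> y \<in> S \<Longrightarrow> b x y = 0"
    and "x \<in> span S" "y \<in> span S"
  shows "b x y = 0"
  using bilinear_on_span_mem[OF assms(1) subspace_single_0 _ assms(3,4)] assms(2) by simp

lemma linear_on_diff:
  assumes "linear_on scale scale S f" "linear_on scale scale S g"
  shows "linear_on scale scale S (\<lambda>x. f x - g x)"
  using assms by (simp add: linear_on_def scale_right_diff_distrib)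

lemma linear_on_compose:
  assumes "linear_on scale scale S f" "\<And>x. x \<in> S \<Longrightarrow> f x \<in> T" "linear_on scale scale T g"
  shows "linear_on scale scale S (\<lambda>x. g (f x))"
  using assms by (simp add: linear_on_def)

lemma linear_on_subset:
  assumes "linear_on scale scale T f" "S \<subseteq> T"
  shows "linear_on scale scale S f"
  using assms unfolding linear_on_def by blast

lemma bilinear_on_subset:
  assumes "bilinear_on scale scale T b" "S \<subseteq> T"
  shows "bilinear_on scale scale S b"
  using assms linear_on_subset unfolding bilinear_on_def by (meson subsetD)

lemma bilinear_on_diff:
  assumes "bilinear_on scale scale S b" "bilinear_on scale scale S b'"
  shows "bilinear_on scale scale S (\<lambda>x y. b x y - b' x y)"
  using assms by (simp add: bilinear_on_def linear_on_diff)

lemma mult_closed: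
  assumes "comm_assoc_graded_algebra scale A" "a \<in> alg_space scale A" "b \<in> alg_space scale A"
  shows "mult A a b \<in> alg_space scale A"
  unfolding total_space_def
proof (rule bilinear_on_span_mem[where S = "\<Union>i. component A i" and b = "mult A"])
  show "bilinear_on scale scale (span (\<Union>i. component A i)) (mult A)"
    using assms(1) by (simp add: comm_assoc_graded_algebra_def total_space_def)
  show "mult A x y \<in> span (\<Union>i. component A i)"
    if "x \<in> (\<Union>i. component A i)" "y \<in> (\<Union>i. component A i)" for x y
  proof -
    from that obtain i j where "x \<in> component A i" "y \<in> component A j" by blast
    then have "mult A x y \<in> component A (i + j)"
      using assms(1) unfolding comm_assoc_graded_algebra_def by blast
    then show ?thesis by (blast intro: span_base)
  qed
qed (use assms in \<open>auto simp: total_space_def\<close>)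

section \<open>Splitting off a homogeneous subspace with zero multiplication\<close>

text \<open>
  The direct sum is required degree by degree for the sums and globally for the intersection, which
  is how both are available from a homogeneous basis. The cocycle is the difference of the two
  products; the condition on this difference says that \<open>A\<close> is the quotient of \<open>E\<close> by \<open>V\<close>.
\<close>

lemma is_graded_central_extensionI:
  assumes E: "comm_assoc_graded_algebra scale E"
    and A: "comm_assoc_graded_algebra scale A"
    and V: "graded_vector_space scale V"
    and sum: "\<And>i. (\<lambda>(a, v). a + v) ` (component A i \<times> V i) = component E i"
    and disjoint: "alg_space scale A \<inter> total_space scale V \<subseteq> {0}"
    and annihilated: "\<And>i v x. v \<in> V i \<Longrightarrow> x \<in> alg_space scale E \<Longrightarrow> mult E v x = 0"
    and quotient: "\<And>i j a b. a \<in> component A i \<Longrightarrow> b \<in> component A j \<Longrightarrow>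
        mult E a b - mult A a b \<in> V (i + j)"
  shows "is_graded_central_extension scale E A V"
proof -
  define AS ES VS where "AS = alg_space scale A" and "ES = alg_space scale E"
    and "VS = total_space scale V"
  note spaces = AS_def ES_def VS_def
  have subspaces: "subspace AS" "subspace ES" "subspace VS"
    by (simp_all add: spaces total_space_def)
  have biE: "bilinear_on scale scale ES (mult E)"
    and commE: "\<And>a b. a \<in> ES \<Longrightarrow> b \<in> ES \<Longrightarrow> mult E a b = mult E b a"
    and assocE: "\<And>a b c. a \<in> ES \<Longrightarrow> b \<in> ES \<Longrightarrow> c \<in> ES \<Longrightarrow>
        mult E (mult E a b) c = mult E a (mult E b c)"
    using E unfolding comm_assoc_graded_algebra_def spaces by blast+
  have biA: "bilinear_on scale scale AS (mult A)"
    and commA: "\<And>a b. a \<in> AS \<Longrightarrow> b \<in> AS \<Longrightarrow> mult A a b = mult A b a"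
    and assocA: "\<And>a b c. a \<in> AS \<Longrightarrow> b \<in> AS \<Longrightarrow> c \<in> AS \<Longrightarrow>
        mult A (mult A a b) c = mult A a (mult A b c)"
    using A unfolding comm_assoc_graded_algebra_def spaces by blast+
  have zeroA: "0 \<in> component A i" and zeroV: "0 \<in> V i" for i
    using A V by (auto simp: comm_assoc_graded_algebra_def graded_vector_space_def subspace_0)
  have "component A i \<subseteq> component E i" for i
    using sum[of i] zeroV[of i] by force
  then have AE: "AS \<subseteq> ES"
    unfolding spaces total_space_def by (intro span_mono UN_mono) auto
  have "V i \<subseteq> component E i" for i
    using sum[of i] zeroA[of i] by force
  then have VE: "VS \<subseteq> ES"
    unfolding spaces total_space_def by (intro span_mono UN_mono) auto
  have closedA: "mult A a b \<in> AS" if "a \<in> AS" "b \<in> AS" for a b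
    using mult_closed[OF A] that by (simp add: spaces)
  have ann: "mult E v x = 0" if "v \<in> VS" "x \<in> ES" for v x
  proof -
    have "linear_on scale scale VS (\<lambda>v. mult E v x)"
      using biE that(2) linear_on_subset[OF _ VE] by (auto simp: bilinear_on_def)
    then show ?thesis
      using that annihilated
      by (auto simp: spaces total_space_def intro: linear_on_span_zero[where S = "\<Union>i. V i"])
  qed
  have addE: "mult E (x + y) z = mult E x z + mult E y z" if "x \<in> ES" "y \<in> ES" "z \<in> ES" for x y z
    using biE that by (simp add: bilinear_on_def linear_on_def)
  have mod_V: "mult E (a + v) b = mult E a b" if "a \<in> ES" "v \<in> VS" "b \<in> ES" for a v b
    using addE[of a v b] ann that VE by auto

  define \<theta> where "\<theta> = (\<lambda>a b. mult E a b - mult A a b)"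
  have bi\<theta>: "bilinear_on scale scale AS \<theta>"
    unfolding \<theta>_def by (intro bilinear_on_diff biA bilinear_on_subset[OF biE AE])
  have \<theta>V: "\<theta> a b \<in> VS" if "a \<in> AS" "b \<in> AS" for a b
  proof (rule bilinear_on_span_mem[where S = "\<Union>i. component A i" and b = \<theta>])
    show "\<theta> x y \<in> VS" if "x \<in> (\<Union>i. component A i)" "y \<in> (\<Union>i. component A i)" for x y
      using that quotient unfolding \<theta>_def spaces total_space_def by (blast intro: span_base)
  qed (use that bi\<theta> subspaces in \<open>auto simp: spaces total_space_def\<close>)
  have inner: "mult E (mult A a b) c = mult E (mult E a b) c" if "a \<in> AS" "b \<in> AS" "c \<in> AS" for a b c
  proof -
    have "mult E (mult A a b + \<theta> a b) c = mult E (mult A a b) c"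
      using closedA[OF that(1,2)] \<theta>V[OF that(1,2)] that AE by (intro mod_V) auto
    then show ?thesis by (simp add: \<theta>_def)
  qed
  have cocycle: "\<theta> (mult A a b) c = \<theta> a (mult A b c)" if "a \<in> AS" "b \<in> AS" "c \<in> AS" for a b c
  proof -
    have inE: "a \<in> ES" "b \<in> ES" "c \<in> ES" using that AE by auto
    have bcE: "mult E b c \<in> ES"
      using mult_closed[OF E] inE by (simp add: spaces)
    have "mult E a (mult A b c) = mult E (mult A b c) a"
      using that AE closedA by (intro commE) auto
    also have "\<dots> = mult E (mult E b c) a"
      by (rule inner) (use that in auto)
    also have "\<dots> = mult E (mult E a b) c"
      using commE[OF bcE inE(1)] assocE[OF inE] by simp
    finally show ?thesis
      using inner[OF that] assocA[OF that] by (simp add: \<theta>_def)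
  qed
  have "\<theta> a b = \<theta> b a" if "a \<in> AS" "b \<in> AS" for a b
    unfolding \<theta>_def commA[OF that] commE[OF subsetD[OF AE that(1)] subsetD[OF AE that(2)]] ..
  moreover have "\<theta> a b \<in> V (i + j)" if "a \<in> component A i" "b \<in> component A j" for i j a b
    using quotient[OF that] by (simp add: \<theta>_def)
  ultimately have "graded_2_cocycle scale A scale V \<theta>"
    unfolding graded_2_cocycle_def spaces[symmetric] using \<theta>V bi\<theta> cocycle by simp
  moreover have "graded_algebra_iso (module_prod.scale scale scale) (central_extension A V \<theta>) scale E
      (\<lambda>(a, v). a + v)" (is "graded_algebra_iso ?s ?X scale E ?f")
  proof -
    interpret P: module_prod scale scale ..
    interpret L: module_hom ?s scale ?f
      by unfold_locales (auto simp: P.scale_def scale_right_distrib)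
    define XS where "XS = alg_space ?s ?X"
    have comp: "component ?X i = component A i \<times> V i" for i
      by (simp add: central_extension_def)
    have XS_eq: "XS = P.p.span (\<Union>i. component A i \<times> V i)"
      by (simp add: XS_def total_space_def comp)
    have "P.p.subspace (AS \<times> VS)"
      using subspaces by (intro P.subspace_Times)
    moreover have "(\<Union>i. component A i \<times> V i) \<subseteq> AS \<times> VS"
      unfolding spaces total_space_def by (blast intro: span_base)
    ultimately have XS: "XS \<subseteq> AS \<times> VS"
      unfolding XS_eq by (rule P.p.span_minimal[rotated])
    have "?f ` XS = span (?f ` (\<Union>i. component A i \<times> V i))"
      unfolding XS_eq by (rule L.span_image[symmetric])
    also have "\<dots> = ES"
      unfolding image_UN sum by (simp add: spaces total_space_def)
    finally have image: "?f ` XS = ES" .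
    have "inj_on ?f (AS \<times> VS)"
    proof (rule inj_onI, clarify)
      fix a v b w assume *: "a \<in> AS" "v \<in> VS" "b \<in> AS" "w \<in> VS" "a + v = b + w"
      then have "a - b = w - v" by (simp add: algebra_simps)
      moreover have "a - b \<in> AS" "w - v \<in> VS"
        using * subspaces by (auto intro: subspace_diff)
      ultimately have "a - b = 0" using disjoint by (auto simp: spaces)
      then show "a = b \<and> v = w" using *(5) by simp
    qed
    then have bij: "bij_betw ?f XS ES"
      using image inj_on_subset[OF _ XS] by (auto simp: bij_betw_def)
    have mult: "?f (mult ?X x y) = mult E (?f x) (?f y)" if xy: "x \<in> XS" "y \<in> XS" for x y
    proof -
      obtain a v b w where eq: "x = (a, v)" "y = (b, w)" by (cases x, cases y)
      then have in_AV: "a \<in> AS" "v \<in> VS" "b \<in> AS" "w \<in> VS" using xy XS by auto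
      then have in_E: "a \<in> ES" "b \<in> ES" "b + w \<in> ES"
        using AE VE subspaces by (auto intro: subspace_add)
      have "mult E (a + v) (b + w) = mult E a (b + w)"
        using in_AV in_E by (intro mod_V)
      also have "\<dots> = mult E (b + w) a" using in_E by (intro commE)
      also have "\<dots> = mult E b a" using in_AV in_E by (intro mod_V)
      also have "\<dots> = mult E a b" using in_E by (intro commE)
      finally show ?thesis by (simp add: eq central_extension_def \<theta>_def)
    qed
    show ?thesis
      unfolding graded_algebra_iso_def XS_def[symmetric] ES_def[symmetric]
      using bij mult sum by (simp add: comp linear_on_def L.add L.scale)
  qed
  ultimately show ?thesis
    using E A V unfolding is_graded_central_extension_def by blast
qed

section \<open>Diagonally graded algebras\<close>

lemma total_space_lines:
  "total_space scale (\<lambda>i. if i \<in> D then span {p i} else {0}) = span (p ` D)"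
proof -
  have "(\<Union>i. if i \<in> D then span {p i} else {0}) \<subseteq> span (p ` D)"
    using span_mono[of "{p i}" "p ` D" for i] by (auto simp: span_zero split: if_splits)
  moreover have "p ` D \<subseteq> (\<Union>i. if i \<in> D then span {p i} else {0})"
    by (auto intro: span_base)
  ultimately show ?thesis
    unfolding total_space_def by (intro antisym span_minimal span_mono) auto
qed

text \<open>
  A relation between homogeneous elements of distinct degrees is a relation between distinct basis
  vectors, once the scalars are reindexed by the vectors \<open>p i\<close> instead of the degrees \<open>i\<close>.
\<close>

lemma graded_vector_space_lines:
  assumes "0 \<notin> D" "inj_on p D" "independent (p ` D)"
  shows "graded_vector_space scale (\<lambda>i. if i \<in> D then span {p i} else {0})"
  unfolding graded_vector_space_def
proof (intro conjI allI impI ballI)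
  fix I x i
  assume asm: "finite I \<and> (\<forall>i\<in>I. x i \<in> (if i \<in> D then span {p i} else {0})) \<and> (\<Sum>i\<in>I. x i) = 0"
    and i: "i \<in> I"
  then have "\<forall>i\<in>I \<inter> D. x i \<in> span {p i}" by auto
  then have "\<forall>i\<in>I \<inter> D. \<exists>c. x i = scale c (p i)"
    unfolding span_singleton by blast
  then obtain c where c: "\<And>i. i \<in> I \<inter> D \<Longrightarrow> x i = scale (c i) (p i)" by metis
  have inj: "inj_on p (I \<inter> D)" using assms(2) by (rule inj_on_subset) auto
  have "(\<Sum>v\<in>p ` (I \<inter> D). scale (c (the_inv_into (I \<inter> D) p v)) v) = (\<Sum>i\<in>I \<inter> D. x i)"
    using inj by (simp add: sum.reindex the_inv_into_f_f c)
  also have "\<dots> = (\<Sum>i\<in>I. x i)"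
  proof (rule sum.mono_neutral_left)
    show "\<forall>i\<in>I - I \<inter> D. x i = 0"
    proof
      fix j assume "j \<in> I - I \<inter> D"
      then show "x j = 0" using bspec[OF conjunct1[OF conjunct2[OF asm]], of j] by simp
    qed
  qed (use asm in auto)
  finally have "(\<Sum>v\<in>p ` (I \<inter> D). scale (c (the_inv_into (I \<inter> D) p v)) v) = 0"
    using asm by simp
  moreover have "finite (p ` (I \<inter> D))" "p ` (I \<inter> D) \<subseteq> p ` D"
    using asm by auto
  ultimately have zero: "c (the_inv_into (I \<inter> D) p v) = 0" if "v \<in> p ` (I \<inter> D)" for v
    using independentD[OF assms(3), where u = "\<lambda>v. c (the_inv_into (I \<inter> D) p v)"] that by metis
  show "x i = 0"
  proof (cases "i \<in> D")
    case True
    then have "c i = 0"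
      using zero[of "p i"] i inj by (simp add: the_inv_into_f_f)
    then show ?thesis using c[of i] True i by simp
  next
    case False
    then show ?thesis using bspec[OF conjunct1[OF conjunct2[OF asm]] i] by simp
  qed
qed (use assms in \<open>auto simp: vector_space_axioms subspace_single_0\<close>)

lemma component_dgca:
  "component (dgca scale n C p) = (\<lambda>i. if i \<in> {1..n} then span {p i} else {0})"
  by (simp add: dgca_def)

lemma alg_space_dgca: "alg_space scale (dgca scale n C p) = span (p ` {1..n})"
  unfolding component_dgca by (rule total_space_lines)

lemma bilinear_on_mult_dgca:
  assumes "independent (p ` {1..n})"
  shows "bilinear_on scale scale (span (p ` {1..n})) (mult (dgca scale n C p))"
  using assms
  by (auto simp: bilinear_on_def linear_on_def dgca_def representation_add representation_scale
      distrib_left distrib_right scale_left_distrib sum.distrib scale_sum_right mult_ac)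

lemma mult_dgca_scaled_basis:
  assumes "inj_on p {1..n}" "independent (p ` {1..n})" "i \<in> {1..n}" "j \<in> {1..n}"
  shows "mult (dgca scale n C p) (scale a (p i)) (scale b (p j)) = scale (a * b * C i j) (p (i + j))"
proof -
  have "p i \<in> span (p ` {1..n})" "p j \<in> span (p ` {1..n})"
    using assms by (auto intro: span_base)
  then show ?thesis
    using bilinear_on_mult_dgca[OF assms(2), of C] dgca_mult_basis[OF vector_space_axioms assms, of C]
    by (simp add: bilinear_on_def linear_on_def span_scale mult_ac)
qed

text \<open>
  Both laws are linear in each variable, so it suffices to test them on basis vectors; there
  commutativity is symmetry of \<open>C\<close>, and associativity is the equation in the definition of
  \<open>dgca_matrices\<close>. The products of degree above \<open>n\<close> are zero on both sides.
\<close>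

lemma comm_assoc_graded_algebra_dgca:
  assumes C: "C \<in> dgca_matrices n" and inj: "inj_on p {1..n}" and ind: "independent (p ` {1..n})"
  shows "comm_assoc_graded_algebra scale (dgca scale n C p)"
proof -
  let ?m = "mult (dgca scale n C p)" and ?P = "p ` {1..n}"
  note basis = dgca_mult_basis[OF vector_space_axioms inj ind]
  note bi = bilinear_on_mult_dgca[OF ind, of C]
  have linl: "linear_on scale scale (span ?P) (\<lambda>x. ?m x y)"
    and linr: "linear_on scale scale (span ?P) (\<lambda>x. ?m y x)" if "y \<in> span ?P" for y
    using bi that by (auto simp: bilinear_on_def)
  have sym: "C i j = C j i" and vanish: "i + j > n \<Longrightarrow> C i j = 0" for i j
    using C by (auto simp: dgca_matrices_def)
  have cocycle: "C j k * C i (j + k) = C i j * C (i + j) k" if "i \<ge> 1" "j \<ge> 1" "k \<ge> 1" for i j k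
    using C that by (auto simp: dgca_matrices_def)
  have graded: "?m a b \<in> component (dgca scale n C p) (i + j)"
    if ab: "a \<in> component (dgca scale n C p) i" "b \<in> component (dgca scale n C p) j" for i j a b
  proof (cases "i \<in> {1..n} \<and> j \<in> {1..n}")
    case True
    then obtain c d where "a = scale c (p i)" "b = scale d (p j)"
      using ab by (auto simp: component_dgca span_singleton)
    then have "?m a b = scale (c * d * C i j) (p (i + j))"
      using True mult_dgca_scaled_basis[OF inj ind] by blast
    then show ?thesis
      using True vanish[of i j]
      by (cases "i + j \<le> n") (auto simp: component_dgca span_singleton)
  next
    case False
    then have "a = 0 \<or> b = 0"
      using ab by (auto simp: component_dgca split: if_splits)
    then have "?m a b = 0"
      by (auto simp: dgca_def representation_zero)
    then show ?thesis
      by (simp add: component_dgca span_zero)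
  qed
  have closed: "?m a b \<in> span ?P" if ab: "a \<in> span ?P" "b \<in> span ?P" for a b
  proof (rule bilinear_on_span_mem[OF bi _ _ ab])
    fix x y assume "x \<in> ?P" "y \<in> ?P"
    then obtain i j where ij: "x = p i" "y = p j" "i \<in> {1..n}" "j \<in> {1..n}" by auto
    show "?m x y \<in> span ?P"
    proof (cases "i + j \<le> n")
      case True
      then have "p (i + j) \<in> ?P" using ij by simp
      then show ?thesis using ij basis[of i j C] by (simp add: span_scale span_base)
    next
      case False
      then show ?thesis using ij basis[of i j C] vanish[of i j] by (simp add: span_zero)
    qed
  qed simp
  have comm: "?m a b = ?m b a" if ab: "a \<in> span ?P" "b \<in> span ?P" for a b
  proof -
    have "bilinear_on scale scale (span ?P) (\<lambda>x y. ?m y x)"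
      using bi by (auto simp: bilinear_on_def)
    then have "?m a b - ?m b a = 0"
      by (rule bilinear_on_span_zero[OF bilinear_on_diff[OF bi] _ ab])
        (use basis sym in \<open>auto simp: add.commute\<close>)
    then show ?thesis by simp
  qed
  have assoc_basis: "?m (?m (p i) (p j)) (p k) = ?m (p i) (?m (p j) (p k))"
    if ijk: "i \<in> {1..n}" "j \<in> {1..n}" "k \<in> {1..n}" for i j k
  proof -
    \<comment> \<open>The vector \<open>p (i + j)\<close> is a basis vector only if \<open>i + j \<le> n\<close>; otherwise its coefficient is \<open>0\<close>.\<close>
    have l: "?m (scale (C i j) (p (i + j))) (p k) = scale (C i j * C (i + j) k) (p (i + j + k))"
    proof (cases "i + j \<le> n")
      case True
      then show ?thesis
        using mult_dgca_scaled_basis[OF inj ind, of "i + j" k C "C i j" 1] ijk by simp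
    qed (simp add: vanish dgca_def representation_zero)
    have r: "?m (p i) (scale (C j k) (p (j + k))) = scale (C j k * C i (j + k)) (p (i + j + k))"
    proof (cases "j + k \<le> n")
      case True
      then show ?thesis
        using mult_dgca_scaled_basis[OF inj ind, of i "j + k" C 1 "C j k"] ijk
        by (simp add: add.assoc)
    qed (simp add: vanish dgca_def representation_zero)
    show ?thesis
      using l r basis ijk cocycle[of i j k] by simp
  qed
  have assoc: "?m (?m a b) c = ?m a (?m b c)"
    if abc: "a \<in> span ?P" "b \<in> span ?P" "c \<in> span ?P" for a b c
  proof -
    have lin1: "linear_on scale scale (span ?P) (\<lambda>x. ?m (?m x y) z - ?m x (?m y z))"
      and lin2: "linear_on scale scale (span ?P) (\<lambda>x. ?m (?m y x) z - ?m y (?m x z))"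
      and lin3: "linear_on scale scale (span ?P) (\<lambda>x. ?m (?m y z) x - ?m y (?m z x))"
      if yz: "y \<in> span ?P" "z \<in> span ?P" for y z
      by (intro linear_on_diff linl linr closed yz
          linear_on_compose[OF linl _ linl] linear_on_compose[OF linr _ linl]
          linear_on_compose[OF linl _ linr] linear_on_compose[OF linr _ linr]; assumption)+
    have "?m (?m x y) c - ?m x (?m y c) = 0" if "x \<in> ?P" "y \<in> ?P" for x y
      using that assoc_basis
      by (intro linear_on_span_zero[OF lin3 _ abc(3)]) (auto intro: span_base)
    then have "?m (?m a b) c - ?m a (?m b c) = 0"
      by (intro bilinear_on_span_zero[where b = "\<lambda>x y. ?m (?m x y) c - ?m x (?m y c)", OF _ _ abc(1,2)])
        (use lin1 lin2 abc(3) in \<open>simp_all add: bilinear_on_def\<close>)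
    then show ?thesis by simp
  qed
  have "graded_vector_space scale (component (dgca scale n C p))"
    unfolding component_dgca by (rule graded_vector_space_lines) (use inj ind in auto)
  then show ?thesis
    unfolding comm_assoc_graded_algebra_def alg_space_dgca
    using bi graded comm assoc by blast
qed

lemma dgca_is_graded_central_extension:
  assumes n: "n > 0" and C: "C \<in> dgca_matrices n" and inj: "inj_on p {1..n}"
    and ind: "independent (p ` {1..n})"
  shows "is_graded_central_extension scale (dgca scale n C p)
           (dgca scale (n - 1) (truncate_matrix n C) p) (line_in_degree scale n (p n))"
proof -
  have subset: "{1..n - 1} \<subseteq> {1..n}" by auto
  have inj': "inj_on p {1..n - 1}" using inj subset by (rule inj_on_subset)
  have ind': "independent (p ` {1..n - 1})"
    using ind by (rule independent_mono) (use subset in auto)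
  have line: "line_in_degree scale n (p n) = (\<lambda>i. if i \<in> {n} then span {p i} else {0})"
    by (rule ext) (auto simp: line_in_degree_def)
  have split: "{1..n} = insert n {1..n - 1}" using n by auto
  show ?thesis
  proof (rule is_graded_central_extensionI)
    show "comm_assoc_graded_algebra scale (dgca scale n C p)"
      using C inj ind by (rule comm_assoc_graded_algebra_dgca)
    show "comm_assoc_graded_algebra scale (dgca scale (n - 1) (truncate_matrix n C) p)"
      using truncate_matrix_in_dgca_matrices[OF C] inj' ind' by (rule comm_assoc_graded_algebra_dgca)
    have "independent (p ` {n})"
      using ind by (rule independent_mono) (use n in auto)
    then show "graded_vector_space scale (line_in_degree scale n (p n))"
      unfolding line using n by (intro graded_vector_space_lines) auto
    show "(\<lambda>(a, v). a + v) ` (component (dgca scale (n - 1) (truncate_matrix n C) p) i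
        \<times> line_in_degree scale n (p n) i) = component (dgca scale n C p) i" for i
      using n by (force simp: component_dgca line_in_degree_def image_iff)
    show "alg_space scale (dgca scale (n - 1) (truncate_matrix n C) p)
        \<inter> total_space scale (line_in_degree scale n (p n)) \<subseteq> {0}"
    proof
      fix x assume "x \<in> alg_space scale (dgca scale (n - 1) (truncate_matrix n C) p)
        \<inter> total_space scale (line_in_degree scale n (p n))"
      then have x: "x \<in> span (p ` {1..n - 1})" "x \<in> span {p n}"
        unfolding line alg_space_dgca total_space_lines by auto
      obtain c where c: "x = scale c (p n)" using x(2) by (auto simp: span_singleton)
      have "p n \<notin> p ` {1..n - 1}"
        using inj_on_image_mem_iff[OF inj _ subset, of n] n by simp
      then have "p n \<notin> span (p ` {1..n - 1})"
        using ind unfolding split by (simp add: independent_insert)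
      then have "c = 0"
        using x(1) span_scale[of x "p ` {1..n - 1}" "inverse c"] by (cases "c = 0") (auto simp: c)
      then show "x \<in> {0}" by (simp add: c)
    qed
    show "mult (dgca scale n C p) v x = 0"
      if v: "v \<in> line_in_degree scale n (p n) i" and x: "x \<in> alg_space scale (dgca scale n C p)"
      for i v x
    proof -
      obtain c where c: "v = scale c (p n)"
        using v by (auto simp: line_in_degree_def span_singleton split: if_splits
            intro: that[of 0])
      have vP: "v \<in> span (p ` {1..n})"
        unfolding c using n by (intro span_scale span_base) auto
      have "C n j = 0" if "j \<in> {1..n}" for j
        using C that by (auto simp: dgca_matrices_def)
      then have "mult (dgca scale n C p) v (p j) = 0" if "j \<in> {1..n}" for j
        using mult_dgca_scaled_basis[OF inj ind, of n j C c 1] n that by (simp add: c)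
      then have "mult (dgca scale n C p) v y = 0" if "y \<in> p ` {1..n}" for y
        using that by blast
      moreover have "linear_on scale scale (span (p ` {1..n})) (mult (dgca scale n C p) v)"
        using bilinear_on_mult_dgca[OF ind, of C] vP unfolding bilinear_on_def by blast
      ultimately show ?thesis
        using x linear_on_span_zero unfolding alg_space_dgca by blast
    qed
    show "mult (dgca scale n C p) a b - mult (dgca scale (n - 1) (truncate_matrix n C) p) a b
        \<in> line_in_degree scale n (p n) (i + j)"
      if a: "a \<in> component (dgca scale (n - 1) (truncate_matrix n C) p) i"
        and b: "b \<in> component (dgca scale (n - 1) (truncate_matrix n C) p) j" for i j a b
    proof (cases "i \<in> {1..n - 1} \<and> j \<in> {1..n - 1}")
      case True
      then obtain c d where cd: "a = scale c (p i)" "b = scale d (p j)"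
        using a b by (auto simp: component_dgca span_singleton)
      have "mult (dgca scale n C p) a b = scale (c * d * C i j) (p (i + j))"
        unfolding cd using True subset by (intro mult_dgca_scaled_basis[OF inj ind]) blast+
      moreover have "mult (dgca scale (n - 1) (truncate_matrix n C) p) a b
          = scale (c * d * truncate_matrix n C i j) (p (i + j))"
        unfolding cd using True by (intro mult_dgca_scaled_basis[OF inj' ind']) blast+
      ultimately have diff: "mult (dgca scale n C p) a b
          - mult (dgca scale (n - 1) (truncate_matrix n C) p) a b
          = scale (c * d * (C i j - truncate_matrix n C i j)) (p (i + j))"
        by (simp add: scale_left_diff_distrib right_diff_distrib)
      show ?thesis
      proof (cases "i + j = n")
        case True
        then show ?thesis
          unfolding diff by (simp add: line_in_degree_def span_scale span_base)
      next
        case False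
        then have "C i j = truncate_matrix n C i j"
          using C by (auto simp: dgca_matrices_def truncate_matrix_def not_less)
        then show ?thesis
          unfolding diff using False by (simp add: line_in_degree_def)
      qed
    next
      case False
      then have "a = 0 \<or> b = 0"
        using a b unfolding component_dgca by (metis singletonD)
      then have "mult (dgca scale n C p) a b = 0"
        "mult (dgca scale (n - 1) (truncate_matrix n C) p) a b = 0"
        by (auto simp: dgca_def representation_zero)
      then show ?thesis
        by (simp add: line_in_degree_def span_zero)
    qed
  qed
qed

end

theorem proposition3p1:
  fixes smul :: "'k::alg_closed_field \<Rightarrow> 'v::ab_group_add \<Rightarrow> 'v"
    and n :: nat
    and C :: "nat \<Rightarrow> nat \<Rightarrow> 'k"
    and p :: "nat \<Rightarrow> 'v"
  assumes "vector_space smul"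
    and "n > 0"
    and "C \<in> dgca_matrices n"
    and "inj_on p {1..n}"
    and "\<not> module.dependent smul (p ` {1..n})"
  shows "is_graded_central_extension smul
           (dgca smul n C p)
           (dgca smul (n - 1) (truncate_matrix n C) p)
           (line_in_degree smul n (p n))"
  using assms by (rule vector_space.dgca_is_graded_central_extension)

end
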